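(* Let $L\ge 1$ be an integer, $\sigma\in(0,2\pi]$, $0<T_{\mathrm{cm}}<T_{\mathrm{fr}}$, $R_1,R_2>0$, $\gamma_1,\gamma_2>0$, and consider the two-user beam-alignment problem described in the context, with beliefs $S_k$, supports $\mathcal S_{k,i}$, uncertainty widths $U_{k,i}=|\mathcal S_{k,i}|$, beam-widths $\omega_{k,i}=|\mathcal S_{k,i}\cap\mathcal B_k|$, energy functions $\epsilon_i$ and minimum average power $$\bar P_{\mathrm{avg}}=\min_{\pi}\ \mathbb E_\pi\left[\frac{U_{L,1}}{T_{\mathrm{fr}}}\,\epsilon_1(\tau_1)+\frac{U_{L,2}}{T_{\mathrm{fr}}}\,\epsilon_2(T_{\mathrm{cm}}-\tau_1)\right].$$ Then the optimal beam-widths during the beam-alignment phase are given by $$\omega_{k,i}=\tfrac12 U_{k,i},\qquad i\in\{1,2\},\ k=0,1,\dots,L-1,$$ that is, a policy that uses beam shapes $\mathcal B_k$ with these beam-widths in every slot, together with a time allocation $\tau_1\in(0,T_{\mathrm{cm}})$ minimizing $U_{L,1}\epsilon_1(\tau_1)+U_{L,2}\epsilon_2(T_{\mathrm{cm}}-\tau_1)$ at the end of the beam-alignment phase, attains the minimum $\bar P_{\mathrm{avg}}$. Moreover, $$\bar P_{\mathrm{avg}}=\frac{\sigma}{T_{\mathrm{fr}}\,2^{L}}\Big[\epsilon_1(\tau_1^* )+\epsilon_2(T_{\mathrm{cm}}-\tau_1^* )\Big],$$ where $\tau_1^*$ is the unique element of $(0,T_{\mathrm{cm}})$ satisfying $$\frac{\epsilon_2'(T_{\mathrm{cm}}-\tau_1^*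 )}{\epsilon_1'(\tau_1^* )}=1 .$$
   Context: Notation: $|\mathcal A|$ is the Lebesgue measure of a measurable set $\mathcal A\subseteq[-\pi,\pi]$; $\chi(\cdot)$ is the indicator function; primes denote derivatives. Users. There are two users with angles $\Theta_1,\Theta_2$, independent and uniformly distributed on $[-\sigma/2,\sigma/2]$. Beam-alignment phase. In each slot $k=0,1,\dots,L-1$ the base station chooses a beam shape, i.e. a measurable set $\mathcal B_k\subseteq[-\pi,\pi]$, the same for both users, and then observes error-free feedback $C_{k,i}=\chi(\Theta_i\in\mathcal B_k)$, $i=1,2$. Belief. $S_k(\theta_1,\theta_2)$ is the conditional probability density of $(\Theta_1,\Theta_2)$ given the beam shapes and feedback of slots $0,\dots,k-1$. Thus $S_0(\theta_1,\theta_2)=\sigma^{-2}\chi(\theta_1\in[-\frac\sigma2,\frac\sigma2])\,\chi(\theta_2\in[-\frac\sigma2,\frac\sigma2])$ and, for feedback $(c_{k,1},c_{k,2})\in\{0,1\}^2$ of positive probability, $S_{k+1}$ is obtained by Bayes' rule: $$S_{k+1}(\theta_1,\theta_2)=\frac{p(c_{k,1}|\theta_1,\mathcal B_k)\,p(c_{k,2}|\theta_2,\mathcal B_k)\,S_k(\theta_1,\theta_2)}{\int_{-\pi}^{\pi}\int_{-\pi}^{\pi}p(c_{k,1}|\tilde\theta_1,\mathcal B_k)\,p(c_{k,2}|\tilde\theta_2,\mathcal B_k)\,S_k(\tilde\theta_1,\tilde\theta_2)\,\mathrm d\tilde\theta_1\mathrm d\tilde\theta_2},$$ where $p(1|\theta,\mathcal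 B)=\chi(\theta\in\mathcal B)$ and $p(0|\theta,\mathcal B)=1-\chi(\theta\in\mathcal B)$. Widths. $S_{k,i}$ is the $i$-th marginal density of $S_k$, $\mathcal S_{k,i}=\{\theta: S_{k,i}(\theta)>0\}$ is its support (the uncertainty region of user $i$), $U_{k,i}=|\mathcal S_{k,i}|$ is the uncertainty width, and $\omega_{k,i}=|\mathcal S_{k,i}\cap\mathcal B_k|$ is the beam-width within the uncertainty region of user $i$. Communication phase. After slot $L-1$, the base station chooses $\tau_1\in(0,T_{\mathrm{cm}})$, transmits to user 1 for time $\tau_1$ and to user 2 for time $T_{\mathrm{cm}}-\tau_1$, with beam shapes $\mathcal B_{L,i}=\mathcal S_{L,i}$ (hence of width $U_{L,i}$) and with the power needed to support rate $R_i$ over a frame of duration $T_{\mathrm{fr}}$. The resulting energies are $U_{L,1}\epsilon_1(\tau_1)$ and $U_{L,2}\epsilon_2(T_{\mathrm{cm}}-\tau_1)$, where for $\tau>0$ $$\epsilon_i(\tau)=\tau\,\frac{2^{\frac{T_{\mathrm{fr}}}{\tau}R_i}-1}{\gamma_i}.$$ Policies. A policy $\pi=(\pi_0,\dots,\pi_L)$ selects $\mathcal B_k=\pi_k(S_k)$ for $k=0,\dots,L-1$ and $\tau_1=\pi_L(S_L)\in(0,T_{\mathrm{cm}})$. $\mathbb E_\pi$ is the expectation over $(\Theta_1,\Theta_2)$ when policy $\pi$ is used. *)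

theory Defs
  imports "HOL-Probability.Probability"
begin

text \<open>
  A belief is a joint density on pairs of angles.  All measurability and all integrals refer to
  the Lebesgue (completed) measure, since beam shapes are arbitrary Lebesgue measurable sets.
\<close>

type_synonym belief = "real \<times> real \<Rightarrow> real"

definition prior :: "real \<Rightarrow> belief" where
  "prior \<sigma> = (\<lambda>(\<theta>1, \<theta>2).
     1 / \<sigma>\<^sup>2 * indicator {- \<sigma> / 2 .. \<sigma> / 2} \<theta>1 * indicator {- \<sigma> / 2 .. \<sigma> / 2} \<theta>2)"

definition likelihood :: "bool \<Rightarrow> real \<Rightarrow> real set \<Rightarrow> real" where
  "likelihood c \<theta> B = (if c then indicator B \<theta> else 1 - indicator B \<theta>)"

text \<open>
  For feedback of probability zero the denominator vanishes and the updated belief is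
  the zero function.
\<close>

definition bayes_update :: "real set \<Rightarrow> bool \<Rightarrow> bool \<Rightarrow> belief \<Rightarrow> belief" where
  "bayes_update B c1 c2 S = (\<lambda>(\<theta>1, \<theta>2).
     likelihood c1 \<theta>1 B * likelihood c2 \<theta>2 B * S (\<theta>1, \<theta>2) /
     (LINT t1 : {- pi .. pi} | lebesgue. LINT t2 : {- pi .. pi} | lebesgue.
        likelihood c1 t1 B * likelihood c2 t2 B * S (t1, t2)))"

definition support1 :: "belief \<Rightarrow> real set" where
  "support1 S = {\<theta>. (LINT t : {- pi .. pi} | lebesgue. S (\<theta>, t)) > 0}"

definition support2 :: "belief \<Rightarrow> real set" where
  "support2 S = {\<theta>. (LINT t : {- pi .. pi} | lebesgue. S (t, \<theta>)) > 0}"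

abbreviation width :: "real set \<Rightarrow> real" where
  "width A \<equiv> measure lebesgue A"

definition energy :: "real \<Rightarrow> real \<Rightarrow> real \<Rightarrow> real \<Rightarrow> real" where
  "energy T_fr R \<gamma> \<tau> = \<tau> * ((2 powr (T_fr / \<tau> * R) - 1) / \<gamma>)"

record policy =
  beam :: "nat \<Rightarrow> belief \<Rightarrow> real set"
  alloc :: "belief \<Rightarrow> real"

definition policies :: "nat \<Rightarrow> real \<Rightarrow> policy set" where
  "policies L T_cm = {\<pi>.
     (\<forall>k<L. \<forall>S. beam \<pi> k S \<in> sets lebesgue \<and> beam \<pi> k S \<subseteq> {- pi .. pi}) \<and>
     (\<forall>S. alloc \<pi> S \<in> {0 <..< T_cm})}"

text \<open>
  The belief at the start of slot \<open>k\<close> when the true angles are \<open>\<theta>1\<close> and \<open>\<theta>2\<close>.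
\<close>

primrec belief_at :: "real \<Rightarrow> policy \<Rightarrow> nat \<Rightarrow> real \<Rightarrow> real \<Rightarrow> belief" where
  "belief_at \<sigma> \<pi> 0 \<theta>1 \<theta>2 = prior \<sigma>"
| "belief_at \<sigma> \<pi> (Suc k) \<theta>1 \<theta>2 =
     (let S = belief_at \<sigma> \<pi> k \<theta>1 \<theta>2; B = beam \<pi> k S
      in bayes_update B (\<theta>1 \<in> B) (\<theta>2 \<in> B) S)"

text \<open>
  In the following, \<open>e1\<close> and \<open>e2\<close> are the energies per unit beam-width of the two users as
  functions of their transmission times.
\<close>

definition total_energy ::
    "real \<Rightarrow> (real \<Rightarrow> real) \<Rightarrow> (real \<Rightarrow> real) \<Rightarrow> belief \<Rightarrow> real \<Rightarrow> real" where
  "total_energy T_cm e1 e2 S \<tau> =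
     width (support1 S) * e1 \<tau> + width (support2 S) * e2 (T_cm - \<tau>)"

definition avg_power ::
    "'a measure \<Rightarrow> ('a \<Rightarrow> real) \<Rightarrow> ('a \<Rightarrow> real) \<Rightarrow> real \<Rightarrow> nat \<Rightarrow> real \<Rightarrow> real \<Rightarrow>
     (real \<Rightarrow> real) \<Rightarrow> (real \<Rightarrow> real) \<Rightarrow> policy \<Rightarrow> real" where
  "avg_power M \<Theta>1 \<Theta>2 \<sigma> L T_fr T_cm e1 e2 \<pi> =
     (LINT x | M. (let S = belief_at \<sigma> \<pi> L (\<Theta>1 x) (\<Theta>2 x); \<tau> = alloc \<pi> S
        in width (support1 S) / T_fr * e1 \<tau> + width (support2 S) / T_fr * e2 (T_cm - \<tau>)))"

definition min_avg_power ::
    "'a measure \<Rightarrow> ('a \<Rightarrow> real) \<Rightarrow> ('a \<Rightarrow> real) \<Rightarrow> real \<Rightarrow> nat \<Rightarrow> real \<Rightarrow> real \<Rightarrow>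
     (real \<Rightarrow> real) \<Rightarrow> (real \<Rightarrow> real) \<Rightarrow> real" where
  "min_avg_power M \<Theta>1 \<Theta>2 \<sigma> L T_fr T_cm e1 e2 =
     (INF \<pi> \<in> policies L T_cm. avg_power M \<Theta>1 \<Theta>2 \<sigma> L T_fr T_cm e1 e2 \<pi>)"

text \<open>
  The following two conditions are almost sure: they concern exactly the beliefs reached
  with positive probability.
\<close>

definition half_width_beams ::
    "'a measure \<Rightarrow> ('a \<Rightarrow> real) \<Rightarrow> ('a \<Rightarrow> real) \<Rightarrow> real \<Rightarrow> nat \<Rightarrow> policy \<Rightarrow> bool" where
  "half_width_beams M \<Theta>1 \<Theta>2 \<sigma> L \<pi> \<longleftrightarrow>
     (AE x in M. \<forall>k<L. let S = belief_at \<sigma> \<pi> k (\<Theta>1 x) (\<Theta>2 x); B = beam \<pi> k S in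
        width (support1 S \<inter> B) = 1 / 2 * width (support1 S) \<and>
        width (support2 S \<inter> B) = 1 / 2 * width (support2 S))"

definition optimal_alloc ::
    "'a measure \<Rightarrow> ('a \<Rightarrow> real) \<Rightarrow> ('a \<Rightarrow> real) \<Rightarrow> real \<Rightarrow> nat \<Rightarrow> real \<Rightarrow>
     (real \<Rightarrow> real) \<Rightarrow> (real \<Rightarrow> real) \<Rightarrow> policy \<Rightarrow> bool" where
  "optimal_alloc M \<Theta>1 \<Theta>2 \<sigma> L T_cm e1 e2 \<pi> \<longleftrightarrow>
     (AE x in M. let S = belief_at \<sigma> \<pi> L (\<Theta>1 x) (\<Theta>2 x) in
        is_arg_min (total_energy T_cm e1 e2 S) (\<lambda>\<tau>. \<tau> \<in> {0 <..< T_cm}) (alloc \<pi> S))"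

end

theory Submission
  imports Defs
begin

text \<open>
  After any feedback history the belief is uniform on a rectangle \<open>A1 \<times> A2\<close>, and a history has
  probability \<open>|A1| |A2| / \<sigma>\<^sup>2\<close>.  Each slot doubles the sum over histories of \<open>|A1|\<close> and of \<open>|A2|\<close>,
  so with \<open>c = \<sigma> / 2 ^ L\<close> the expectations of \<open>1 / U1\<close> and \<open>1 / U2\<close> over non-null
  histories are at most \<open>1 / c\<close>.

  The energy functions are log-convex.  With \<open>ln x \<le> x - 1\<close> this gives, at the balanced split \<open>s\<close>,
  the pointwise bound \<open>U1 e1(\<tau>) + U2 e2(T - \<tau>) \<ge> 2 c (e1(s) + e2(T - s)) - c\<^sup>2 (e1(s) / U1 + e2(T - s) / U2)\<close>
  for every \<open>\<tau>\<close>, since the first-order terms in \<open>\<tau> - s\<close> cancel.  Taking expectations bounds every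
  policy from below by \<open>c (e1(s) + e2(T - s))\<close>, which is attained when every width is exactly halved.
  A single beam can halve both uncertainty regions: bisect \<open>A1 - A2\<close>, \<open>A1 \<inter> A2\<close> and \<open>A2 - A1\<close> separately.
\<close>

section \<open>The energy function\<close>

lemma energy_eq_exp:
  assumes "\<tau> \<noteq> 0"
  shows "energy T R \<gamma> \<tau> = \<tau> * (exp (T * R * ln 2 / \<tau>) - 1) / \<gamma>"
  using assms by (simp add: energy_def powr_def mult_ac)

text \<open>The derivative of \<open>energy\<close> in closed form; for positive parameters the
  exponent \<open>x\<close> is a decreasing function of the time \<tau>.\<close>

definition energy_slope :: "real \<Rightarrow> real \<Rightarrow> real \<Rightarrow> real \<Rightarrow> real" where
  "energy_slope T R \<gamma> \<tau> =
     (let x = T * R * ln 2 / \<tau> in (exp x * (1 - x) - 1) / \<gamma>)"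

lemma has_real_derivative_energy:
  assumes "0 < \<tau>"
  shows "(energy T R \<gamma> has_real_derivative energy_slope T R \<gamma> \<tau>) (at \<tau>)"
proof -
  define a where "a = T * R * ln 2"
  have "((\<lambda>\<tau>. \<tau> * (exp (a / \<tau>) - 1)) has_real_derivative exp (a / \<tau>) * (1 - a / \<tau>) - 1) (at \<tau>)"
    using assms by (auto intro!: derivative_eq_intros simp: field_simps)
  from DERIV_cdivide[OF this, of \<gamma>]
  have "((\<lambda>\<tau>. \<tau> * (exp (T * R * ln 2 / \<tau>) - 1) / \<gamma>) has_real_derivative
      energy_slope T R \<gamma> \<tau>) (at \<tau>)"
    unfolding energy_slope_def Let_def a_def .
  \<comment> \<open>\<open>energy_eq_exp\<close> covers nonzero times, so the two formulas are
    identified on a neighbourhood of \<tau> that avoids 0.\<close>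
  moreover have "\<forall>\<^sub>F t in nhds \<tau>. t \<noteq> 0"
    using assms by (intro t1_space_nhds) auto
  ultimately show ?thesis
    by (subst DERIV_cong_ev[OF refl _ refl])
       (auto elim!: eventually_mono simp: energy_eq_exp)
qed

lemma deriv_energy: "0 < \<tau> \<Longrightarrow> deriv (energy T R \<gamma>) \<tau> = energy_slope T R \<gamma> \<tau>"
  by (intro DERIV_imp_deriv has_real_derivative_energy)

lemma energy_pos:
  assumes "0 < T" "0 < R" "0 < \<gamma>" "0 < \<tau>"
  shows "0 < energy T R \<gamma> \<tau>"
  using assms by (simp add: energy_eq_exp)

text \<open>The derivative is \<open>- (x * exp x)\<close>. Up to constants this function is the
  energy slope in terms of the exponent, so its decrease becomes strict convexity of the
  energy.\<close>

lemma exp_mult_one_minus_strict_antimono: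
  fixes x y :: real
  assumes "0 < x" "x < y"
  shows "exp y * (1 - y) < exp x * (1 - x)"
proof (rule DERIV_neg_imp_decreasing[OF assms(2)])
  fix z assume "x \<le> z" "z \<le> y"
  have "((\<lambda>x. exp x * (1 - x)) has_real_derivative - (z * exp z)) (at z)"
    by (auto intro!: derivative_eq_intros simp: algebra_simps)
  moreover have "- (z * exp z) < 0" using assms \<open>x \<le> z\<close> by simp
  ultimately show "\<exists>d. ((\<lambda>x. exp x * (1 - x)) has_real_derivative d) (at z) \<and> d < 0"
    by blast
qed

lemma energy_slope_strict_mono:
  assumes "0 < T" "0 < R" "0 < \<gamma>" "0 < s" "s < t"
  shows "energy_slope T R \<gamma> s < energy_slope T R \<gamma> t"
proof -
  have "T * R * ln 2 / t < T * R * ln 2 / s" "0 < T * R * ln 2 / t"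
    using assms by (auto intro!: divide_strict_left_mono)
  from exp_mult_one_minus_strict_antimono[OF this(2,1)] show ?thesis
    using assms by (simp add: energy_slope_def Let_def divide_strict_right_mono)
qed

text \<open>Equivalent to \<open>1 - x < exp (- x)\<close>. Negativity is what makes the quotient of
  derivatives in the theorem meaningful.\<close>

lemma energy_slope_neg:
  assumes "0 < T" "0 < R" "0 < \<gamma>" "0 < \<tau>"
  shows "energy_slope T R \<gamma> \<tau> < 0"
proof -
  define x where "x = T * R * ln 2 / \<tau>"
  have x: "0 < x" using assms by (simp add: x_def)
  have "1 - x < exp (- x)"
    using x exp_minus_greater by blast
  hence "exp x * (1 - x) < 1"
    by (simp add: exp_minus field_simps)
  thus ?thesis using assms by (simp add: energy_slope_def Let_def x_def divide_neg_pos)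
qed

lemma continuous_on_energy_slope: "continuous_on {0<..} (energy_slope T R \<gamma>)"
  unfolding energy_slope_def Let_def divide_inverse by (intro continuous_intros) auto

text \<open>As the time tends to 0 the exponent tends to infinity and \<open>- x * exp x\<close>
  dominates. This divergence forces the sign change needed for a balanced split.\<close>

lemma filterlim_energy_slope:
  assumes "0 < T" "0 < R" "0 < \<gamma>"
  shows "filterlim (energy_slope T R \<gamma>) at_bot (at_right 0)"
proof -
  define a where "a = T * R * ln 2"
  have "0 < a" using assms by (simp add: a_def)
  thus ?thesis
    unfolding energy_slope_def Let_def a_def[symmetric] using assms(3) by real_asymp
qed

text \<open>The difference \<open>d1 \<tau> - d2 (T - \<tau>)\<close> is strictly increasing, hence
  uniqueness. It tends to minus infinity near 0 and to infinity near \<open>T\<close>, hence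
  existence by the intermediate value theorem.\<close>

lemma ex1_balanced_split:
  fixes d1 d2 :: "real \<Rightarrow> real"
  assumes mono: "\<And>s t. 0 < s \<Longrightarrow> s < t \<Longrightarrow> d1 s < d1 t" "\<And>s t. 0 < s \<Longrightarrow> s < t \<Longrightarrow> d2 s < d2 t"
    and cont: "continuous_on {0<..} d1" "continuous_on {0<..} d2"
    and lim: "filterlim d1 at_bot (at_right 0)" "filterlim d2 at_bot (at_right 0)"
    and "0 < T"
  shows "\<exists>!\<tau>. \<tau> \<in> {0<..<T} \<and> d2 (T - \<tau>) = d1 \<tau>"
proof -
  have small: "\<exists>s. 0 < s \<and> s \<le> T / 2 \<and> f s \<le> z"
    if "filterlim f at_bot (at_right 0)" for f :: "real \<Rightarrow> real" and z
  proof -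
    have "\<forall>\<^sub>F s in at_right 0. f s \<le> z"
      using that by (auto simp: filterlim_at_bot)
    moreover have "\<forall>\<^sub>F s in at_right 0. s \<in> {0<..<T/2}"
      using \<open>0 < T\<close> by (intro eventually_at_right_real) auto
    ultimately have "\<forall>\<^sub>F s in at_right 0. f s \<le> z \<and> s \<in> {0<..<T/2}"
      by eventually_elim auto
    from eventually_happens'[OF _ this] show ?thesis by force
  qed
  \<comment> \<open>Keeping both points within \<open>T / 2\<close> allows the opposite slope to be
    compared with its value at the midpoint, and gives \<open>s \<le> T - t\<close>.\<close>
  obtain s where s: "0 < s" "s \<le> T / 2" "d1 s \<le> d2 (T / 2)" using small[OF lim(1)] by blast
  obtain t where t: "0 < t" "t \<le> T / 2" "d2 t \<le> d1 (T / 2)" using small[OF lim(2)] by blast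
  define f where "f \<tau> = d1 \<tau> - d2 (T - \<tau>)" for \<tau>
  have mono': "d1 x \<le> d1 y" "d2 x \<le> d2 y" if "0 < x" "x \<le> y" for x y
    using mono[of x y] that by (cases "x = y"; force)+
  have "f s \<le> 0" using s mono'(2)[of "T / 2" "T - s"] by (simp add: f_def)
  moreover have "0 \<le> f (T - t)" using t mono'(1)[of "T / 2" "T - t"] by (simp add: f_def)
  moreover have "continuous_on {s..T - t} f"
    unfolding f_def using s t
    by (intro continuous_intros continuous_on_subset[OF cont(1)]
        continuous_on_compose2[OF cont(2)]) auto
  ultimately obtain \<tau> where \<tau>: "s \<le> \<tau>" "\<tau> \<le> T - t" "f \<tau> = 0"
    using IVT'[of f s 0 "T - t"] s t by auto
  have less: "f x < f y" if "0 < x" "x < y" "y < T" for x y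
    using mono(1)[of x y] mono(2)[of "T - y" "T - x"] that by (simp add: f_def)
  show ?thesis
  proof (rule ex1I)
    show "\<tau> \<in> {0<..<T} \<and> d2 (T - \<tau>) = d1 \<tau>" using \<tau> s t by (auto simp: f_def)
    fix y assume y: "y \<in> {0<..<T} \<and> d2 (T - y) = d1 y"
    hence "f y = 0" by (simp add: f_def)
    thus "y = \<tau>" using less[of y \<tau>] less[of \<tau> y] y \<tau> s t by (cases y \<tau> rule: linorder_cases) auto
  qed
qed

section \<open>Log-convexity and the pointwise lower bound\<close>

text \<open>With \<open>x = a / \<tau>\<close> and \<open>a = T * R * ln 2\<close>, the logarithmic derivative of the energy is \<open>- 1 / a\<close> times this function.\<close>

lemma log_derivative_mono:
  fixes x y :: real
  assumes "0 < x" "x \<le> y"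
  shows "x * (x / (1 - exp (- x)) - 1) \<le> y * (y / (1 - exp (- y)) - 1)"
proof -
  \<comment> \<open>The product is monotone since both factors are nonnegative and nondecreasing.
    For this quotient the numerator of the derivative is nonnegative because
    \<open>1 + z \<le> exp z\<close>.\<close>
  have "x / (1 - exp (- x)) \<le> y / (1 - exp (- y))"
  proof (rule DERIV_nonneg_imp_nondecreasing[OF assms(2)])
    fix z assume "x \<le> z" "z \<le> y"
    hence z: "0 < z" using assms by simp
    have "((\<lambda>x. x / (1 - exp (- x))) has_real_derivative
        (1 - exp (- z) - z * exp (- z)) / (1 - exp (- z))\<^sup>2) (at z)"
      using z by (auto intro!: derivative_eq_intros simp: power2_eq_square)
    moreover have "(1 + z) * exp (- z) \<le> 1"
      using exp_ge_add_one_self[of z] by (simp add: exp_minus field_simps)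
    hence "0 \<le> (1 - exp (- z) - z * exp (- z)) / (1 - exp (- z))\<^sup>2"
      by (simp add: algebra_simps)
    ultimately show "\<exists>d. ((\<lambda>x. x / (1 - exp (- x))) has_real_derivative d) (at z) \<and> 0 \<le> d"
      by blast
  qed
  moreover have "0 \<le> x / (1 - exp (- x)) - 1"
  proof -
    have "1 - exp (- x) \<le> x" using exp_ge_add_one_self[of "- x"] by simp
    thus ?thesis using assms by (simp add: field_simps)
  qed
  ultimately show ?thesis using assms by (intro mult_mono) auto
qed

text \<open>Log-convexity: the logarithmic derivative is a decreasing function of
  \<open>a / \<tau>\<close>, hence increasing in \<tau>, and a convex function lies above its
  tangents.\<close>

lemma ln_energy_above_tangent:
  assumes "0 < T" "0 < R" "0 < \<gamma>" "0 < s" "0 < t"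
  shows "energy_slope T R \<gamma> s / energy T R \<gamma> s * (t - s) \<le>
    ln (energy T R \<gamma> t) - ln (energy T R \<gamma> s)"
proof -
  let ?e = "energy T R \<gamma>" and ?d = "energy_slope T R \<gamma>"
  define a where "a = T * R * ln 2"
  have a: "0 < a" using assms by (simp add: a_def)
  have deriv: "((\<lambda>\<tau>. ln (?e \<tau>)) has_real_derivative ?d \<tau> / ?e \<tau>) (at \<tau>)" if "0 < \<tau>" for \<tau>
    using has_real_derivative_energy[OF that, of T R \<gamma>] energy_pos[OF assms(1-3) that]
    by (auto intro!: derivative_eq_intros)
  have eq: "?d \<tau> / ?e \<tau> = - (a / \<tau> * (a / \<tau> / (1 - exp (- (a / \<tau>))) - 1)) / a"
    if "0 < \<tau>" for \<tau>
  proof -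
    define E where "E = exp (a / \<tau>)"
    have "1 < E" using a that by (simp add: E_def)
    have slope: "?d \<tau> = (E * (1 - a / \<tau>) - 1) / \<gamma>" and ediv: "?e \<tau> = \<tau> * (E - 1) / \<gamma>"
      using that by (simp_all add: energy_eq_exp energy_slope_def Let_def a_def E_def)
    have exp_minus: "exp (- (a / \<tau>)) = 1 / E"
      by (simp add: E_def exp_minus inverse_eq_divide)
    show ?thesis
      unfolding slope ediv exp_minus using that a assms(3) \<open>1 < E\<close>
      by (simp add: divide_simps) (simp add: algebra_simps)
  qed
  have "?d x / ?e x \<le> ?d y / ?e y" if "0 < x" "x \<le> y" for x y
  proof -
    have "0 < a / y" "a / y \<le> a / x" using that a by (auto intro!: divide_left_mono)
    hence "- (a / x * (a / x / (1 - exp (- (a / x))) - 1)) / a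
        \<le> - (a / y * (a / y / (1 - exp (- (a / y))) - 1)) / a"
      using a by (intro divide_right_mono le_imp_neg_le log_derivative_mono) auto
    moreover have "0 < y" using that by simp
    ultimately show ?thesis using that by (simp only: eq)
  qed
  hence "convex_on {0<..} (\<lambda>\<tau>. ln (?e \<tau>))"
    by (intro convex_on_realI[where f' = "\<lambda>\<tau>. ?d \<tau> / ?e \<tau>"] deriv) auto
  from convex_on_imp_above_tangent[OF this _ _ _ has_field_derivative_at_within[OF deriv], of s t]
  show ?thesis using assms by (simp add: interior_open)
qed

text \<open>With \<open>a\<close>, \<open>b\<close> the energies at \<open>s\<close>,
  \<open>t\<close>, split \<open>ln b - ln a\<close> as
  \<open>ln (u * b / (c * a)) + ln (c / u)\<close> and apply \<open>ln x \<le> x - 1\<close> to each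
  summand. After scaling by \<open>c * a\<close> the width enters only through \<open>u * b\<close>
  and \<open>1 / u\<close>. Equality holds at \<open>u = c\<close>, \<open>t = s\<close>.\<close>

lemma energy_lower_bound:
  assumes "0 < T" "0 < R" "0 < \<gamma>" "0 < s" "0 < t" "0 < c" "0 < u"
  shows "2 * c * energy T R \<gamma> s + c * energy_slope T R \<gamma> s * (t - s) - c\<^sup>2 * (energy T R \<gamma> s / u)
    \<le> u * energy T R \<gamma> t"
proof -
  define a b d where "a = energy T R \<gamma> s" and "b = energy T R \<gamma> t"
    and "d = energy_slope T R \<gamma> s * (t - s)"
  have pos: "0 < a" "0 < b" using energy_pos assms by (auto simp: a_def b_def)
  have "d / a \<le> ln b - ln a"
    using ln_energy_above_tangent[OF assms(1-5)] by (simp add: a_def b_def d_def)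
  also have "\<dots> = ln (u * b / (c * a)) + ln (c / u)"
    using pos assms by (simp add: ln_div ln_mult)
  also have "\<dots> \<le> (u * b / (c * a) - 1) + (c / u - 1)"
    using pos assms by (intro add_mono ln_le_minus_one) auto
  finally have "c * a * (d / a) \<le> c * a * ((u * b / (c * a) - 1) + (c / u - 1))"
    using pos assms by (intro mult_left_mono) auto
  also have "\<dots> = u * b + c\<^sup>2 * (a / u) - 2 * c * a"
    using pos assms by (simp add: field_simps power2_eq_square)
  finally show ?thesis using pos by (simp add: a_def b_def d_def mult_ac)
qed

text \<open>The second user's time changes by \<open>(T - t) - (T - s) = - (t - s)\<close>, so equal
  slopes cancel the linear terms.\<close>

lemma sum_energy_lower_bound:
  assumes "0 < T_fr" "0 < R1" "0 < R2" "0 < \<gamma>1" "0 < \<gamma>2" "0 < c" "0 < u1" "0 < u2"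
    and "s \<in> {0<..<T}" "t \<in> {0<..<T}"
    and "energy_slope T_fr R2 \<gamma>2 (T - s) = energy_slope T_fr R1 \<gamma>1 s"
  defines "e1 \<equiv> energy T_fr R1 \<gamma>1" and "e2 \<equiv> energy T_fr R2 \<gamma>2"
  shows "2 * c * (e1 s + e2 (T - s)) - c\<^sup>2 * (e1 s / u1 + e2 (T - s) / u2)
    \<le> u1 * e1 t + u2 * e2 (T - t)"
  using energy_lower_bound[of T_fr R1 \<gamma>1 s t c u1] 
    energy_lower_bound[of T_fr R2 \<gamma>2 "T - s" "T - t" c u2] assms
  by (simp add: algebra_simps)

section \<open>Bisection of uncertainty regions\<close>

text \<open>The inclusion keeps widths finite and makes the integrals over
  \<open>{- pi .. pi}\<close> in beliefs see the whole set.\<close>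

definition bounded_angles :: "real set \<Rightarrow> bool" where
  "bounded_angles A \<longleftrightarrow> A \<in> sets lebesgue \<and> A \<subseteq> {- pi .. pi}"

lemma bounded_angles_lmeasurable: "bounded_angles A \<Longrightarrow> A \<in> lmeasurable"
  unfolding bounded_angles_def by (blast intro: fmeasurableI2[OF lmeasurable_interval(1)])

lemma width_Un:
  assumes "A \<in> lmeasurable" "B \<in> lmeasurable" "A \<inter> B = {}"
  shows "width (A \<union> B) = width A + width B"
  using measure_Union[OF fmeasurableD2[OF assms(1), unfolded infinity_ennreal_def[symmetric]]
      fmeasurableD2[OF assms(2), unfolded infinity_ennreal_def[symmetric]]] assms by auto

lemma width_split:
  assumes "A \<in> lmeasurable" "B \<in> sets lebesgue"
  shows "width A = width (A \<inter> B) + width (A \<inter> - B)"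
proof -
  have "A \<inter> B \<in> lmeasurable" "A \<inter> - B \<in> lmeasurable"
    using assms by (auto intro: fmeasurableI2[OF assms(1)])
  hence "width (A \<inter> B \<union> A \<inter> - B) = width (A \<inter> B) + width (A \<inter> - B)"
    by (intro width_Un) auto
  thus ?thesis by (simp add: Int_Un_distrib[symmetric])
qed

text \<open>Cut \<open>A\<close> by a half-line. The width of \<open>A \<inter> {..t}\<close> is
  1-Lipschitz in \<open>t\<close> and grows from 0 at \<open>- pi\<close> to the full width at
  \<open>pi\<close>, so some cut takes exactly half.\<close>

lemma bisecting_subset:
  assumes "bounded_angles A"
  shows "\<exists>B. B \<in> sets lebesgue \<and> B \<subseteq> A \<and> width B = width A / 2"
proof -
  define f where "f t = width (A \<inter> {..t})" for t
  have A: "A \<in> lmeasurable" "A \<in> sets lebesgue" "A \<subseteq> {- pi .. pi}"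
    using assms bounded_angles_lmeasurable[OF assms] by (simp_all add: bounded_angles_def)
  have lip: "f s \<le> f t \<and> f t - f s \<le> t - s" if "s \<le> t" for s t
  proof -
    have [simp, intro]: "{..r} \<in> sets lebesgue" "{r<..} \<in> sets lebesgue" for r :: real by auto
    have "A \<inter> {..t} \<in> lmeasurable" by (intro fmeasurableI2[OF A(1)]) (use A in auto)
    hence "f t = width (A \<inter> {..t} \<inter> {..s}) + width (A \<inter> {..t} \<inter> - {..s})"
      unfolding f_def by (rule width_split) auto
    moreover have "A \<inter> {..t} \<inter> {..s} = A \<inter> {..s}" using that by auto
    moreover have "width (A \<inter> {..t} \<inter> - {..s}) \<le> width {s..t}"
      by (intro measure_mono_fmeasurable) (use A in auto)
    ultimately show ?thesis using that by (simp add: f_def)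
  qed
  have "\<bar>f x - f y\<bar> \<le> \<bar>x - y\<bar>" for x y
    using lip[of x y] lip[of y x] by linarith
  hence "1-lipschitz_on UNIV f" by (intro lipschitz_onI) (auto simp: dist_real_def)
  hence "continuous_on {- pi .. pi} f"
    by (blast intro: lipschitz_on_continuous_on continuous_on_subset)
  moreover have "f (- pi) \<le> width A / 2"
  proof -
    have "f (- pi) \<le> width {- pi .. - pi}"
      unfolding f_def by (intro measure_mono_fmeasurable lmeasurable_interval) (use A in auto)
    thus ?thesis by (simp add: measure_nonneg order_trans[of _ 0])
  qed
  moreover have "f pi = width A"
    unfolding f_def using A(3) by (intro arg_cong[where f = width]) auto
  ultimately obtain t where "f t = width A / 2"
    using IVT'[of f "- pi" "width A / 2" pi] by auto
  thus ?thesis using A by (intro exI[of _ "A \<inter> {..t}"]) (auto simp: f_def)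
qed

text \<open>Half of the overlap serves both users at once, while \<open>P\<close> and
  \<open>R\<close> each miss the other user's region.\<close>

lemma common_bisection:
  assumes "bounded_angles A1" "bounded_angles A2"
  shows "\<exists>B. bounded_angles B \<and> width (A1 \<inter> B) = 1 / 2 * width A1 \<and> width (A2 \<inter> B) = 1 / 2 * width A2"
proof -
  have b: "bounded_angles (A1 - A2)" "bounded_angles (A1 \<inter> A2)" "bounded_angles (A2 - A1)"
    using assms by (auto simp: bounded_angles_def)
  obtain P where P: "P \<in> sets lebesgue" "P \<subseteq> A1 - A2" "width P = width (A1 - A2) / 2"
    using bisecting_subset[OF b(1)] by blast
  obtain Q where Q: "Q \<in> sets lebesgue" "Q \<subseteq> A1 \<inter> A2" "width Q = width (A1 \<inter> A2) / 2"
    using bisecting_subset[OF b(2)] by blast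
  obtain R where R: "R \<in> sets lebesgue" "R \<subseteq> A2 - A1" "width R = width (A2 - A1) / 2"
    using bisecting_subset[OF b(3)] by blast
  have lm: "A1 \<in> lmeasurable" "A2 \<in> lmeasurable"
    by (intro bounded_angles_lmeasurable assms)+
  have "P \<in> lmeasurable" "Q \<in> lmeasurable" "R \<in> lmeasurable"
    using P Q R by (auto intro: fmeasurableI2[OF lm(1)] fmeasurableI2[OF lm(2)])
  hence "width (P \<union> Q) = width P + width Q" "width (R \<union> Q) = width R + width Q"
    using P Q R by (auto intro!: width_Un)
  moreover have "A1 \<inter> (P \<union> Q \<union> R) = P \<union> Q" "A2 \<inter> (P \<union> Q \<union> R) = R \<union> Q"
    using P Q R by auto
  moreover have "width A1 = width (A1 \<inter> A2) + width (A1 - A2)"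
    "width A2 = width (A1 \<inter> A2) + width (A2 - A1)"
    using width_split[OF lm(1), of A2] width_split[OF lm(2), of A1] lm
    by (auto simp: Diff_eq Int_commute)
  ultimately have "width (A1 \<inter> (P \<union> Q \<union> R)) = 1 / 2 * width A1"
    "width (A2 \<inter> (P \<union> Q \<union> R)) = 1 / 2 * width A2"
    using P Q R by simp_all
  moreover have "bounded_angles (P \<union> Q \<union> R)"
    using P Q R assms by (auto simp: bounded_angles_def)
  ultimately show ?thesis by blast
qed

section \<open>Beliefs after a feedback history\<close>

text \<open>If either width is 0, division by zero makes this the zero function, which agrees with
  \<open>bayes_update\<close> on impossible feedback.\<close>

definition uniform_belief :: "real set \<times> real set \<Rightarrow> belief" where
  "uniform_belief R = (\<lambda>(\<theta>1, \<theta>2).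
     indicator (fst R) \<theta>1 * indicator (snd R) \<theta>2 / (width (fst R) * width (snd R)))"

text \<open>The angles consistent with feedback \<open>c\<close>. The complement is unbounded, so
  cells are always intersected with a region before widths are taken.\<close>

definition cell :: "real set \<Rightarrow> bool \<Rightarrow> real set" where
  "cell B c = (if c then B else - B)"

lemma likelihood_eq_indicator: "likelihood c \<theta> B = indicator (cell B c) \<theta>"
  by (simp add: likelihood_def cell_def indicator_def)

lemma cell_measurable: "B \<in> sets lebesgue \<Longrightarrow> cell B c \<in> sets lebesgue"
  using sets.compl_sets[of B lebesgue] by (auto simp: cell_def Compl_eq_Diff_UNIV)

lemma mem_cell_iff: "\<theta> \<in> cell B c \<longleftrightarrow> (\<theta> \<in> B) = c"
  by (simp add: cell_def)

lemma bounded_angles_Int_cell: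
  "bounded_angles A \<Longrightarrow> B \<in> sets lebesgue \<Longrightarrow> bounded_angles (A \<inter> cell B c)"
  using cell_measurable[of B c] by (auto simp: bounded_angles_def)

lemma set_integral_indicator:
  assumes "bounded_angles A"
  shows "(LINT t : {- pi .. pi} | lebesgue. k * indicator A t) = k * width A"
proof -
  have "(LINT t : {- pi .. pi} | lebesgue. k * indicator A t) = (LINT t | lebesgue. k * indicator A t)"
    unfolding set_lebesgue_integral_def
    using assms by (intro Bochner_Integration.integral_cong) (auto simp: bounded_angles_def indicator_def)
  thus ?thesis by simp
qed

text \<open>Because \<open>x / 0 = 0\<close>, this also holds for feedback of probability zero: both sides vanish.\<close>

lemma bayes_update_uniform_belief:
  assumes "bounded_angles A1" "bounded_angles A2" "B \<in> sets lebesgue"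
  shows "bayes_update B c1 c2 (uniform_belief (A1, A2)) =
    uniform_belief (A1 \<inter> cell B c1, A2 \<inter> cell B c2)"
proof -
  let ?A1 = "A1 \<inter> cell B c1" and ?A2 = "A2 \<inter> cell B c2"
  define w where "w = width A1 * width A2"
  have b: "bounded_angles ?A1" "bounded_angles ?A2" using assms by (auto intro: bounded_angles_Int_cell)
  have post: "likelihood c1 s B * likelihood c2 t B * uniform_belief (A1, A2) (s, t) =
      indicator ?A1 s / w * indicator ?A2 t" for s t
    by (auto simp: likelihood_eq_indicator uniform_belief_def w_def indicator_def)
  have "(LINT s : {- pi .. pi} | lebesgue. LINT t : {- pi .. pi} | lebesgue.
      indicator ?A1 s / w * indicator ?A2 t) =
    (LINT s : {- pi .. pi} | lebesgue. width ?A2 / w * indicator ?A1 s)"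
    unfolding set_integral_indicator[OF b(2)] by (simp add: mult.commute)
  also have "\<dots> = width ?A1 * width ?A2 / w"
    unfolding set_integral_indicator[OF b(1)] by simp
  finally have denom: "(LINT s : {- pi .. pi} | lebesgue. LINT t : {- pi .. pi} | lebesgue.
      indicator ?A1 s / w * indicator ?A2 t) = width ?A1 * width ?A2 / w" .
  \<comment> \<open>If the old rectangle is null then so is the new one, and both beliefs are zero;
    otherwise the factor \<open>w\<close> cancels from the quotient.\<close>
  have "width ?A1 \<le> width A1" "width ?A2 \<le> width A2"
    using assms b by (auto intro!: measure_mono_fmeasurable bounded_angles_lmeasurable
        simp: bounded_angles_def)
  hence "w = 0 \<Longrightarrow> width ?A1 * width ?A2 = 0"
    by (auto simp: w_def measure_le_0_iff)
  hence "bayes_update B c1 c2 (uniform_belief (A1, A2)) (s, t) =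
      uniform_belief (?A1, ?A2) (s, t)" for s t
    unfolding bayes_update_def prod.case post denom
    by (cases "w = 0") (auto simp: uniform_belief_def)
  thus ?thesis by (simp add: fun_eq_iff)
qed

text \<open>Integrating out one angle leaves a multiple of the indicator of the other set. Positive
  widths make that multiple positive; a null rectangle has empty supports instead.\<close>

lemma support_uniform_belief:
  assumes "bounded_angles A1" "bounded_angles A2" "0 < width A1" "0 < width A2"
  shows "support1 (uniform_belief (A1, A2)) = A1" "support2 (uniform_belief (A1, A2)) = A2"
proof -
  define w where "w = width A1 * width A2"
  have "0 < w" using assms by (simp add: w_def)
  have "(LINT t : {- pi .. pi} | lebesgue. uniform_belief (A1, A2) (\<theta>, t)) =
      indicator A1 \<theta> / w * width A2" for \<theta>
    using set_integral_indicator[OF assms(2), of "indicator A1 \<theta> / w"]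
    by (simp add: uniform_belief_def w_def)
  thus "support1 (uniform_belief (A1, A2)) = A1"
    using assms \<open>0 < w\<close> by (auto simp: support1_def indicator_def split: if_splits)
  have "(LINT t : {- pi .. pi} | lebesgue. uniform_belief (A1, A2) (t, \<theta>)) =
      indicator A2 \<theta> / w * width A1" for \<theta>
    using set_integral_indicator[OF assms(1), of "indicator A2 \<theta> / w"]
    by (simp add: uniform_belief_def w_def mult.commute)
  thus "support2 (uniform_belief (A1, A2)) = A2"
    using assms \<open>0 < w\<close> by (auto simp: support2_def indicator_def split: if_splits)
qed

text \<open>Ensures that a common bisection exists at every belief of this form, including the zero
  belief of a null rectangle.\<close>

lemma bounded_angles_support:
  assumes "bounded_angles A1" "bounded_angles A2"
  shows "bounded_angles (support1 (uniform_belief (A1, A2)))"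
    "bounded_angles (support2 (uniform_belief (A1, A2)))"
proof -
  have "bounded_angles (support1 (uniform_belief (A1, A2))) \<and>
    bounded_angles (support2 (uniform_belief (A1, A2)))"
  proof (cases "0 < width A1 \<and> 0 < width A2")
    case True
    thus ?thesis using assms by (simp add: support_uniform_belief)
  next
    case False
    hence "width A1 * width A2 = 0" by (auto simp: measure_le_0_iff not_less)
    hence "uniform_belief (A1, A2) = (\<lambda>_. 0)" by (auto simp: uniform_belief_def)
    thus ?thesis by (simp add: support1_def support2_def bounded_angles_def set_lebesgue_integral_def)
  qed
  thus "bounded_angles (support1 (uniform_belief (A1, A2)))"
    "bounded_angles (support2 (uniform_belief (A1, A2)))" by auto
qed

section \<open>Feedback histories and their rectangles\<close>

text \<open>Feedback histories are listed with the most recent slot first.\<close>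

type_synonym feedback = "(bool \<times> bool) list"

text \<open>Indexing by feedback instead of angles leaves finitely many rectangles per slot. The
  history \<open>h\<close> has been recorded in slots before \<open>length h\<close>, so that is the
  slot of the next beam.\<close>

primrec region :: "real \<Rightarrow> policy \<Rightarrow> feedback \<Rightarrow> real set \<times> real set" where
  "region \<sigma> \<pi> [] = ({- \<sigma> / 2 .. \<sigma> / 2}, {- \<sigma> / 2 .. \<sigma> / 2})"
| "region \<sigma> \<pi> (c # h) =
     (let A = region \<sigma> \<pi> h; B = beam \<pi> (length h) (uniform_belief A)
      in (fst A \<inter> cell B (fst c), snd A \<inter> cell B (snd c)))"

primrec history :: "real \<Rightarrow> policy \<Rightarrow> nat \<Rightarrow> real \<Rightarrow> real \<Rightarrow> feedback" where
  "history \<sigma> \<pi> 0 \<theta>1 \<theta>2 = []"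
| "history \<sigma> \<pi> (Suc k) \<theta>1 \<theta>2 =
     (let h = history \<sigma> \<pi> k \<theta>1 \<theta>2; B = beam \<pi> k (uniform_belief (region \<sigma> \<pi> h))
      in (\<theta>1 \<in> B, \<theta>2 \<in> B) # h)"

lemma length_history [simp]: "length (history \<sigma> \<pi> k \<theta>1 \<theta>2) = k"
  by (induction k) (auto simp: Let_def)

text \<open>The beam depends only on the earlier history, and membership in a cell is the feedback
  bit, so consistency peels off slot by slot. Hence the rectangles of one length partition the prior
  square.\<close>

lemma history_eq_iff:
  assumes "\<theta>1 \<in> {- \<sigma> / 2 .. \<sigma> / 2}" "\<theta>2 \<in> {- \<sigma> / 2 .. \<sigma> / 2}"
  shows "history \<sigma> \<pi> (length h) \<theta>1 \<theta>2 = h \<longleftrightarrow>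
    \<theta>1 \<in> fst (region \<sigma> \<pi> h) \<and> \<theta>2 \<in> snd (region \<sigma> \<pi> h)"
proof (induction h)
  case Nil
  thus ?case using assms by simp
next
  case (Cons c h)
  show ?case using Cons.IH by (cases c) (auto simp: Let_def mem_cell_iff)
qed

lemma finite_histories: "finite {h :: feedback. length h = k}"
  using finite_lists_length_eq[of "UNIV :: (bool \<times> bool) set" k] by simp

lemma sum_histories_Suc:
  "(\<Sum>h :: feedback | length h = Suc k. f h) =
   (\<Sum>h | length h = k. \<Sum>c\<in>UNIV. \<Sum>d\<in>UNIV. f ((c, d) # h))"
proof -
  have "{h :: feedback. length h = Suc k} =
      (\<lambda>(h, c, d). (c, d) # h) ` ({h. length h = k} \<times> UNIV \<times> UNIV)"
    by (auto simp: length_Suc_conv image_iff)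
  moreover have "inj_on (\<lambda>(h, c, d). (c, d) # h) ({h :: feedback. length h = k} \<times> UNIV \<times> UNIV)"
    by (auto simp: inj_on_def)
  ultimately have "(\<Sum>h :: feedback | length h = Suc k. f h) =
      (\<Sum>(h, c, d) \<in> {h. length h = k} \<times> UNIV \<times> UNIV. f ((c, d) # h))"
    by (simp add: sum.reindex case_prod_unfold)
  also have "\<dots> = (\<Sum>h | length h = k. \<Sum>c\<in>UNIV. \<Sum>d\<in>UNIV. f ((c, d) # h))"
    by (simp add: sum.cartesian_product case_prod_unfold)
  finally show ?thesis .
qed

section \<open>Regions and widths under an admissible policy\<close>

locale beam_policy =
  fixes \<sigma> T_cm :: real and L :: nat and \<pi> :: policy
  assumes sigma_pos: "0 < \<sigma>" and sigma_le: "\<sigma> \<le> 2 * pi" and policy: "\<pi> \<in> policies L T_cm"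
begin

abbreviation "reg1 h \<equiv> fst (region \<sigma> \<pi> h)"
abbreviation "reg2 h \<equiv> snd (region \<sigma> \<pi> h)"

lemma beam_measurable: "k < L \<Longrightarrow> beam \<pi> k S \<in> sets lebesgue"
  using policy by (auto simp: policies_def)

lemma alloc_range: "alloc \<pi> S \<in> {0<..<T_cm}"
  using policy by (auto simp: policies_def)

lemma bounded_angles_region:
  "length h \<le> L \<Longrightarrow> bounded_angles (reg1 h) \<and> bounded_angles (reg2 h)"
proof (induction h)
  case Nil
  show ?case using sigma_le by (auto simp: bounded_angles_def)
next
  case (Cons c h)
  thus ?case using beam_measurable by (auto simp: Let_def intro!: bounded_angles_Int_cell)
qed

lemma region_subset: "reg1 h \<subseteq> {- \<sigma> / 2 .. \<sigma> / 2} \<and> reg2 h \<subseteq> {- \<sigma> / 2 .. \<sigma> / 2}"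
  by (induction h) (auto simp: Let_def)

text \<open>Bayes' rule intersects each side of the rectangle with the observed cell, which is the
  recursion of \<open>region\<close>.\<close>

lemma belief_at_eq:
  "k \<le> L \<Longrightarrow> belief_at \<sigma> \<pi> k \<theta>1 \<theta>2 = uniform_belief (region \<sigma> \<pi> (history \<sigma> \<pi> k \<theta>1 \<theta>2))"
proof (induction k)
  case 0
  show ?case using sigma_pos
    by (auto simp: prior_def uniform_belief_def fun_eq_iff power2_eq_square)
next
  case (Suc k)
  let ?h = "history \<sigma> \<pi> k \<theta>1 \<theta>2"
  have b: "bounded_angles (reg1 ?h)" "bounded_angles (reg2 ?h)"
    using bounded_angles_region[of ?h] Suc.prems by auto
  show ?case
    using Suc bayes_update_uniform_belief[OF b beam_measurable[of k]] by (simp add: Let_def)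
qed

text \<open>One user's bit splits that user's width into two parts with the same total, and the
  other user's bit counts each part twice. The growth is therefore the same for every
  policy.\<close>

lemma sum_width_region:
  assumes "k \<le> L"
  shows "(\<Sum>h | length h = k. width (reg1 h)) = 2 ^ k * \<sigma>"
    and "(\<Sum>h | length h = k. width (reg2 h)) = 2 ^ k * \<sigma>"
proof -
  have "(\<Sum>h | length h = k. width (reg1 h)) = 2 ^ k * \<sigma> \<and>
    (\<Sum>h | length h = k. width (reg2 h)) = 2 ^ k * \<sigma>"
    using assms
  proof (induction k)
    case 0
    thus ?case using sigma_pos by simp
  next
    case (Suc k)
    have split: "(\<Sum>c\<in>UNIV. \<Sum>d\<in>UNIV. width (reg1 ((c, d) # h))) = 2 * width (reg1 h)"
      "(\<Sum>c\<in>UNIV. \<Sum>d\<in>UNIV. width (reg2 ((c, d) # h))) = 2 * width (reg2 h)"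
      if "length h = k" for h
    proof -
      have "reg1 h \<in> lmeasurable" "reg2 h \<in> lmeasurable"
        using bounded_angles_region[of h] that Suc.prems by (auto intro: bounded_angles_lmeasurable)
      thus "(\<Sum>c\<in>UNIV. \<Sum>d\<in>UNIV. width (reg1 ((c, d) # h))) = 2 * width (reg1 h)"
        "(\<Sum>c\<in>UNIV. \<Sum>d\<in>UNIV. width (reg2 ((c, d) # h))) = 2 * width (reg2 h)"
        using width_split[OF _ beam_measurable[of k "uniform_belief (region \<sigma> \<pi> h)"]] that Suc.prems
        by (simp_all add: UNIV_bool Let_def cell_def)
    qed
    have "(\<Sum>h | length h = Suc k. width (reg1 h)) = (\<Sum>h | length h = k. 2 * width (reg1 h))"
      "(\<Sum>h | length h = Suc k. width (reg2 h)) = (\<Sum>h | length h = k. 2 * width (reg2 h))"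
      unfolding sum_histories_Suc by (intro sum.cong refl split; simp)+
    thus ?case using Suc by (simp add: sum_distrib_left[symmetric])
  qed
  thus "(\<Sum>h | length h = k. width (reg1 h)) = 2 ^ k * \<sigma>"
    "(\<Sum>h | length h = k. width (reg2 h)) = 2 ^ k * \<sigma>" by auto
qed

text \<open>If half of a region lies in the beam, so does half outside, and either feedback halves
  the width. Widths stay positive, so supports coincide with regions throughout. The premise is for
  one pair of angles, to match the almost sure condition.\<close>

lemma width_region_bisected:
  assumes "\<forall>k<L. let S = belief_at \<sigma> \<pi> k \<theta>1 \<theta>2; B = beam \<pi> k S in
        width (support1 S \<inter> B) = 1 / 2 * width (support1 S) \<and>
        width (support2 S \<inter> B) = 1 / 2 * width (support2 S)"
    and "k \<le> L"
  shows "width (reg1 (history \<sigma> \<pi> k \<theta>1 \<theta>2)) = \<sigma> / 2 ^ k \<and>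
    width (reg2 (history \<sigma> \<pi> k \<theta>1 \<theta>2)) = \<sigma> / 2 ^ k"
  using assms(2)
proof (induction k)
  case 0
  show ?case using sigma_pos by simp
next
  case (Suc k)
  define h where "h = history \<sigma> \<pi> k \<theta>1 \<theta>2"
  define B where "B = beam \<pi> k (uniform_belief (region \<sigma> \<pi> h))"
  have k: "k < L" using Suc.prems by simp
  have b: "bounded_angles (reg1 h)" "bounded_angles (reg2 h)"
    using bounded_angles_region[of h] k by (auto simp: h_def)
  have w: "width (reg1 h) = \<sigma> / 2 ^ k" "width (reg2 h) = \<sigma> / 2 ^ k"
    using Suc by (auto simp: h_def)
  have "support1 (uniform_belief (region \<sigma> \<pi> h)) = reg1 h"
    "support2 (uniform_belief (region \<sigma> \<pi> h)) = reg2 h"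
    using support_uniform_belief[OF b] w sigma_pos by simp_all
  hence half: "width (reg1 h \<inter> B) = width (reg1 h) / 2" "width (reg2 h \<inter> B) = width (reg2 h) / 2"
    using assms(1) k by (auto simp: Let_def belief_at_eq h_def B_def)
  have "B \<in> sets lebesgue" unfolding B_def by (rule beam_measurable[OF k])
  hence "width (reg1 h) = width (reg1 h \<inter> B) + width (reg1 h \<inter> - B)"
    "width (reg2 h) = width (reg2 h \<inter> B) + width (reg2 h \<inter> - B)"
    using width_split[OF bounded_angles_lmeasurable[OF b(1)]]
      width_split[OF bounded_angles_lmeasurable[OF b(2)]] by blast+
  hence "width (reg1 h \<inter> cell B c) = width (reg1 h) / 2" "width (reg2 h \<inter> cell B c) = width (reg2 h) / 2" for c
    using half by (simp_all add: cell_def)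
  hence "width (reg1 h \<inter> cell B c) = \<sigma> / 2 ^ Suc k" "width (reg2 h \<inter> cell B c) = \<sigma> / 2 ^ Suc k" for c
    by (simp_all add: w)
  thus ?case by (simp add: Let_def h_def B_def)
qed

lemma width_support_bisected:
  assumes "\<forall>k<L. let S = belief_at \<sigma> \<pi> k \<theta>1 \<theta>2; B = beam \<pi> k S in
        width (support1 S \<inter> B) = 1 / 2 * width (support1 S) \<and>
        width (support2 S \<inter> B) = 1 / 2 * width (support2 S)"
  shows "width (support1 (belief_at \<sigma> \<pi> L \<theta>1 \<theta>2)) = \<sigma> / 2 ^ L"
    "width (support2 (belief_at \<sigma> \<pi> L \<theta>1 \<theta>2)) = \<sigma> / 2 ^ L"
proof -
  let ?h = "history \<sigma> \<pi> L \<theta>1 \<theta>2"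
  have "bounded_angles (reg1 ?h)" "bounded_angles (reg2 ?h)"
    using bounded_angles_region[of ?h] by auto
  from support_uniform_belief[OF this] width_region_bisected[OF assms order_refl] sigma_pos
  show "width (support1 (belief_at \<sigma> \<pi> L \<theta>1 \<theta>2)) = \<sigma> / 2 ^ L"
    "width (support2 (belief_at \<sigma> \<pi> L \<theta>1 \<theta>2)) = \<sigma> / 2 ^ L"
    by (simp_all add: belief_at_eq)
qed

end

section \<open>Expected power of a policy\<close>

locale aligned_users = prob_space M + beam_policy \<sigma> T_cm L \<pi>
  for M :: "'a measure" and \<Theta>1 \<Theta>2 :: "'a \<Rightarrow> real"
    and \<sigma> T_cm :: real and L :: nat and \<pi> :: policy +
  assumes indep: "indep_var lebesgue \<Theta>1 lebesgue \<Theta>2"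
    and unif1: "distr M lebesgue \<Theta>1 = uniform_measure lebesgue {- \<sigma> / 2 .. \<sigma> / 2}"
    and unif2: "distr M lebesgue \<Theta>2 = uniform_measure lebesgue {- \<sigma> / 2 .. \<sigma> / 2}"
begin

abbreviation "hist x \<equiv> history \<sigma> \<pi> L (\<Theta>1 x) (\<Theta>2 x)"

lemma measurable_angles [measurable]:
  "\<Theta>1 \<in> M \<rightarrow>\<^sub>M lebesgue" "\<Theta>2 \<in> M \<rightarrow>\<^sub>M lebesgue"
  using indep by (auto dest: indep_var_rv1 indep_var_rv2)

lemma AE_angles: "AE x in M. \<Theta>1 x \<in> {- \<sigma> / 2 .. \<sigma> / 2} \<and> \<Theta>2 x \<in> {- \<sigma> / 2 .. \<sigma> / 2}"
proof -
  have "AE t in uniform_measure lebesgue {- \<sigma> / 2 .. \<sigma> / 2}. t \<in> {- \<sigma> / 2 .. \<sigma> / 2}"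
    by (intro AE_uniform_measureI) auto
  hence "AE t in distr M lebesgue \<Theta>1. t \<in> {- \<sigma> / 2 .. \<sigma> / 2}"
    "AE t in distr M lebesgue \<Theta>2. t \<in> {- \<sigma> / 2 .. \<sigma> / 2}"
    unfolding unif1 unif2 by auto
  hence "AE x in M. \<Theta>1 x \<in> {- \<sigma> / 2 .. \<sigma> / 2}" "AE x in M. \<Theta>2 x \<in> {- \<sigma> / 2 .. \<sigma> / 2}"
    by (auto simp: AE_distr_iff)
  thus ?thesis by eventually_elim auto
qed

lemma prob_angle:
  assumes "A \<in> sets lebesgue" "A \<subseteq> {- \<sigma> / 2 .. \<sigma> / 2}"
  shows "prob (\<Theta>1 -` A \<inter> space M) = width A / \<sigma>" "prob (\<Theta>2 -` A \<inter> space M) = width A / \<sigma>"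
proof -
  have "measure (uniform_measure lebesgue {- \<sigma> / 2 .. \<sigma> / 2}) A = width A / \<sigma>"
    using assms sigma_pos by (subst measure_uniform_measure) (auto simp: Int_absorb1)
  hence "measure (distr M lebesgue \<Theta>1) A = width A / \<sigma>" "measure (distr M lebesgue \<Theta>2) A = width A / \<sigma>"
    by (simp_all add: unif1 unif2)
  thus "prob (\<Theta>1 -` A \<inter> space M) = width A / \<sigma>" "prob (\<Theta>2 -` A \<inter> space M) = width A / \<sigma>"
    using assms by (simp_all add: measure_distr)
qed

text \<open>For a fixed history the next beam is one fixed Lebesgue set. Histories form a countable
  type, so measurability of each such step suffices.\<close>

lemma measurable_history:
  "k \<le> L \<Longrightarrow> (\<lambda>x. history \<sigma> \<pi> k (\<Theta>1 x) (\<Theta>2 x)) \<in> M \<rightarrow>\<^sub>M count_space UNIV"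
proof (induction k)
  case 0
  show ?case by simp
next
  case (Suc k)
  have step: "(\<lambda>x. let B = beam \<pi> k (uniform_belief (region \<sigma> \<pi> h)) in
      (\<Theta>1 x \<in> B, \<Theta>2 x \<in> B) # h) \<in> M \<rightarrow>\<^sub>M count_space UNIV" for h
  proof -
    have [measurable]: "beam \<pi> k (uniform_belief (region \<sigma> \<pi> h)) \<in> sets lebesgue"
      using Suc.prems by (intro beam_measurable) auto
    show ?thesis unfolding Let_def by measurable
  qed
  show ?case
    using measurable_compose_countable[OF step Suc.IH] Suc.prems by (simp add: Let_def)
qed

text \<open>The rectangles partition the prior square up to a null event, and independence with
  uniformity gives each its normalized area as probability.\<close>

lemma expectation_history:
  fixes g :: "feedback \<Rightarrow> real"
  shows "(LINT x | M. g (hist x)) =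
    (\<Sum>h | length h = L. width (reg1 h) * width (reg2 h) / \<sigma>\<^sup>2 * g h)"
proof -
  define E where "E h = (\<lambda>x. (\<Theta>1 x, \<Theta>2 x)) -` (reg1 h \<times> reg2 h) \<inter> space M" for h
  have reg: "reg1 h \<in> sets lebesgue" "reg2 h \<in> sets lebesgue" if "length h = L" for h
    using bounded_angles_region[of h] that by (auto simp: bounded_angles_def)
  have E_sets: "E h \<in> sets M" if "length h = L" for h
  proof -
    have "E h = (\<Theta>1 -` reg1 h \<inter> space M) \<inter> (\<Theta>2 -` reg2 h \<inter> space M)" by (auto simp: E_def)
    thus ?thesis using reg[OF that] measurable_angles by (auto intro!: sets.Int measurable_sets)
  qed
  have prob_E: "prob (E h) = width (reg1 h) * width (reg2 h) / \<sigma>\<^sup>2" if "length h = L" for h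
    using indep_varD[OF indep reg[OF that]] prob_angle reg[OF that] region_subset[of h]
    by (simp add: E_def power2_eq_square)
  have "(LINT x | M. g (hist x)) = (LINT x | M. (\<Sum>h | length h = L. g h * indicator (E h) x))"
  proof (rule integral_cong_AE)
    show "(\<lambda>x. g (hist x)) \<in> borel_measurable M"
      using measurable_compose[OF measurable_history[OF order_refl], of g borel] by simp
    show "(\<lambda>x. \<Sum>h | length h = L. g h * indicator (E h) x) \<in> borel_measurable M"
      using E_sets by (intro borel_measurable_sum borel_measurable_times) auto
    show "AE x in M. g (hist x) = (\<Sum>h | length h = L. g h * indicator (E h) x)"
      using AE_angles AE_space
    proof eventually_elim
      fix x assume x: "\<Theta>1 x \<in> {- \<sigma> / 2 .. \<sigma> / 2} \<and> \<Theta>2 x \<in> {- \<sigma> / 2 .. \<sigma> / 2}" "x \<in> space M"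
      have mem: "x \<in> E h \<longleftrightarrow> hist x = h" if "length h = L" for h
        using history_eq_iff[of "\<Theta>1 x" \<sigma> "\<Theta>2 x" \<pi> h] x unfolding that E_def by blast
      have "(\<Sum>h | length h = L. g h * indicator (E h) x) =
          (\<Sum>h | length h = L. if h = hist x then g h else 0)"
        by (intro sum.cong refl) (simp add: mem indicator_def eq_commute[of _ "hist x"])
      also have "\<dots> = g (hist x)"
        by (simp add: sum.delta[OF finite_histories])
      finally show "g (hist x) = (\<Sum>h | length h = L. g h * indicator (E h) x)" by simp
    qed
  qed
  also have "\<dots> = (\<Sum>h | length h = L. LINT x | M. g h * indicator (E h) x)"
    using E_sets by (intro Bochner_Integration.integral_sum) (auto simp: less_top[symmetric])
  also have "\<dots> = (\<Sum>h | length h = L. width (reg1 h) * width (reg2 h) / \<sigma>\<^sup>2 * g h)"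
    using E_sets by (intro sum.cong) (auto simp: prob_E sets.sets_into_space Int_absorb2)
  finally show ?thesis .
qed

lemma sum_region_area: "(\<Sum>h | length h = L. width (reg1 h) * width (reg2 h) / \<sigma>\<^sup>2) = 1"
  using expectation_history[of "\<lambda>_. 1"] by (simp add: prob_space)

definition history_power :: "real \<Rightarrow> (real \<Rightarrow> real) \<Rightarrow> (real \<Rightarrow> real) \<Rightarrow> feedback \<Rightarrow> real" where
  "history_power T_fr e1 e2 h =
     (let S = uniform_belief (region \<sigma> \<pi> h) in total_energy T_cm e1 e2 S (alloc \<pi> S) / T_fr)"

lemma avg_power_eq:
  "avg_power M \<Theta>1 \<Theta>2 \<sigma> L T_fr T_cm e1 e2 \<pi> = (LINT x | M. history_power T_fr e1 e2 (hist x))"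
  by (simp add: avg_power_def history_power_def total_energy_def belief_at_eq Let_def add_divide_distrib)

text \<open>Weighted by the probability of \<open>h\<close>, the term \<open>a / u1\<close> becomes
  \<open>a * width (reg2 h) / \<sigma>\<^sup>2\<close>: linear in the other user's width, whose sum
  over histories is known.\<close>

lemma avg_power_lower_bound:
  assumes bound: "\<And>u1 u2 t. 0 < u1 \<Longrightarrow> 0 < u2 \<Longrightarrow> t \<in> {0<..<T_cm} \<Longrightarrow>
      2 * c * (a + b) - c\<^sup>2 * (a / u1 + b / u2) \<le> u1 * e1 t + u2 * e2 (T_cm - t)"
    and c: "c = \<sigma> / 2 ^ L" and "0 < a" "0 < b" "0 < T_fr"
  shows "c * (a + b) / T_fr \<le> avg_power M \<Theta>1 \<Theta>2 \<sigma> L T_fr T_cm e1 e2 \<pi>"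
proof -
  define p where "p h = width (reg1 h) * width (reg2 h) / \<sigma>\<^sup>2" for h
  \<comment> \<open>The pointwise bound times \<open>p h\<close>, multiplied out so that it contains
    no division by a width and can be summed over null histories too.\<close>
  define d where "d h = 2 * c * (a + b) * p h
      - c\<^sup>2 / \<sigma>\<^sup>2 * (a * width (reg2 h) + b * width (reg1 h))" for h
  have "d h / T_fr \<le> p h * history_power T_fr e1 e2 h" if "length h = L" for h
  proof (cases "0 < width (reg1 h) \<and> 0 < width (reg2 h)")
    case True
    have "bounded_angles (reg1 h)" "bounded_angles (reg2 h)"
      using bounded_angles_region[of h] that by auto
    from support_uniform_belief[OF this] True
    have hp: "history_power T_fr e1 e2 h = (width (reg1 h) * e1 (alloc \<pi> (uniform_belief (region \<sigma> \<pi> h))) +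
        width (reg2 h) * e2 (T_cm - alloc \<pi> (uniform_belief (region \<sigma> \<pi> h)))) / T_fr"
      by (simp add: history_power_def total_energy_def Let_def)
    have "d h = p h * (2 * c * (a + b) - c\<^sup>2 * (a / width (reg1 h) + b / width (reg2 h)))"
      using True sigma_pos by (simp add: d_def p_def field_simps)
    also have "\<dots> \<le> p h * (T_fr * history_power T_fr e1 e2 h)"
      using bound[of "width (reg1 h)" "width (reg2 h)", OF _ _ alloc_range] True \<open>0 < T_fr\<close>
      by (intro mult_left_mono) (auto simp: p_def hp)
    finally show ?thesis using \<open>0 < T_fr\<close> by (simp add: field_simps)
  next
    case False
    \<comment> \<open>A null history contributes nothing to the power, while only the subtracted
      terms of \<open>d h\<close> survive.\<close>
    hence "p h = 0" by (auto simp: p_def measure_le_0_iff not_less)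
    moreover have "0 \<le> c\<^sup>2 / \<sigma>\<^sup>2 * (a * width (reg2 h) + b * width (reg1 h))"
      using assms by (intro mult_nonneg_nonneg add_nonneg_nonneg) auto
    ultimately have "d h \<le> 0" by (simp add: d_def)
    thus ?thesis using \<open>p h = 0\<close> \<open>0 < T_fr\<close> by (simp add: divide_nonpos_pos)
  qed
  hence "(\<Sum>h | length h = L. d h / T_fr) \<le> avg_power M \<Theta>1 \<Theta>2 \<sigma> L T_fr T_cm e1 e2 \<pi>"
    unfolding avg_power_eq expectation_history p_def[symmetric] by (intro sum_mono) auto
  moreover have "(\<Sum>h | length h = L. d h) = 
      2 * c * (a + b) * (\<Sum>h | length h = L. p h) - c\<^sup>2 / \<sigma>\<^sup>2 *
      (a * (\<Sum>h | length h = L. width (reg2 h)) + b * (\<Sum>h | length h = L. width (reg1 h)))"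
    unfolding d_def by (simp only: sum_subtractf sum.distrib sum_distrib_left[symmetric])
  moreover have "\<dots> = 2 * c * (a + b) - c\<^sup>2 / \<sigma>\<^sup>2 * (a * (2 ^ L * \<sigma>) + b * (2 ^ L * \<sigma>))"
    using sum_region_area by (simp add: sum_width_region p_def)
  \<comment> \<open>This identity fixes the choice of \<open>c\<close>: the correction is exactly
    half of the leading term.\<close>
  moreover have "c\<^sup>2 / \<sigma>\<^sup>2 * (a * (2 ^ L * \<sigma>) + b * (2 ^ L * \<sigma>)) = c * (a + b)"
    using sigma_pos by (simp add: c power2_eq_square field_simps)
  ultimately show ?thesis by (simp add: sum_divide_distrib[symmetric] algebra_simps)
qed

text \<open>Both final widths equal \<open>\<sigma> / 2 ^ L\<close>, so the total energy is a
  multiple of \<open>e1 t + e2 (T_cm - t)\<close>. The allocation and \<open>s\<close> both minimize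
  it, so their values agree even without identifying the two times.\<close>

lemma avg_power_bisected:
  assumes "half_width_beams M \<Theta>1 \<Theta>2 \<sigma> L \<pi>" and "optimal_alloc M \<Theta>1 \<Theta>2 \<sigma> L T_cm e1 e2 \<pi>"
    and s: "s \<in> {0<..<T_cm}" and min: "\<And>t. t \<in> {0<..<T_cm} \<Longrightarrow> e1 s + e2 (T_cm - s) \<le> e1 t + e2 (T_cm - t)"
  shows "avg_power M \<Theta>1 \<Theta>2 \<sigma> L T_fr T_cm e1 e2 \<pi> = \<sigma> / 2 ^ L * (e1 s + e2 (T_cm - s)) / T_fr"
proof -
  have "AE x in M. history_power T_fr e1 e2 (hist x) = \<sigma> / 2 ^ L * (e1 s + e2 (T_cm - s)) / T_fr"
    using assms(1,2) unfolding half_width_beams_def optimal_alloc_def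
  proof eventually_elim
    case (elim x)
    let ?S = "belief_at \<sigma> \<pi> L (\<Theta>1 x) (\<Theta>2 x)"
    have total: "total_energy T_cm e1 e2 ?S t = \<sigma> / 2 ^ L * (e1 t + e2 (T_cm - t))" for t
      using width_support_bisected[OF elim(1)] by (simp add: total_energy_def distrib_left)
    have "total_energy T_cm e1 e2 ?S (alloc \<pi> ?S) \<le> total_energy T_cm e1 e2 ?S s"
      using elim(2) s by (auto simp: is_arg_min_linorder Let_def)
    moreover have "total_energy T_cm e1 e2 ?S s \<le> total_energy T_cm e1 e2 ?S (alloc \<pi> ?S)"
      unfolding total using min[OF alloc_range] sigma_pos by (intro mult_left_mono) auto
    ultimately have "total_energy T_cm e1 e2 ?S (alloc \<pi> ?S) = total_energy T_cm e1 e2 ?S s"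
      by (rule antisym)
    thus ?case
      by (simp add: history_power_def Let_def belief_at_eq[symmetric] total[of s])
  qed
  hence "(LINT x | M. history_power T_fr e1 e2 (hist x)) =
      (LINT x | M. \<sigma> / 2 ^ L * (e1 s + e2 (T_cm - s)) / T_fr)"
    using measurable_compose[OF measurable_history[OF order_refl], of "history_power T_fr e1 e2" borel]
    by (intro integral_cong_AE) auto
  thus ?thesis by (simp add: avg_power_eq prob_space)
qed

end

section \<open>A bisecting policy and the minimum power\<close>

text \<open>\<open>policies\<close> constrains the beam at every function \<open>S\<close>, so the
  halving property is put under an implication and the choice is an admissible beam in all
  cases.\<close>

definition bisecting_beam :: "belief \<Rightarrow> real set" where
  "bisecting_beam S = (SOME B. bounded_angles B \<and>
     (bounded_angles (support1 S) \<and> bounded_angles (support2 S) \<longrightarrow>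
       width (support1 S \<inter> B) = 1 / 2 * width (support1 S) \<and>
       width (support2 S \<inter> B) = 1 / 2 * width (support2 S)))"

lemma bisecting_beam:
  "bounded_angles (bisecting_beam S)"
  "bounded_angles (support1 S) \<Longrightarrow> bounded_angles (support2 S) \<Longrightarrow>
     width (support1 S \<inter> bisecting_beam S) = 1 / 2 * width (support1 S) \<and>
     width (support2 S \<inter> bisecting_beam S) = 1 / 2 * width (support2 S)"
proof -
  have "bounded_angles {}" by (simp add: bounded_angles_def)
  hence "\<exists>B. bounded_angles B \<and> (bounded_angles (support1 S) \<and> bounded_angles (support2 S) \<longrightarrow>
       width (support1 S \<inter> B) = 1 / 2 * width (support1 S) \<and>
       width (support2 S \<inter> B) = 1 / 2 * width (support2 S))"
    using common_bisection by blast
  from someI_ex[OF this, folded bisecting_beam_def]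
  show "bounded_angles (bisecting_beam S)"
    "bounded_angles (support1 S) \<Longrightarrow> bounded_angles (support2 S) \<Longrightarrow>
     width (support1 S \<inter> bisecting_beam S) = 1 / 2 * width (support1 S) \<and>
     width (support2 S \<inter> bisecting_beam S) = 1 / 2 * width (support2 S)"
    by blast+
qed

theorem theorem3:
  fixes M :: "'a measure" and \<Theta>1 \<Theta>2 :: "'a \<Rightarrow> real"
    and L :: nat and \<sigma> T_cm T_fr R1 R2 \<gamma>1 \<gamma>2 :: real
    and e1 e2 :: "real \<Rightarrow> real"
  assumes "prob_space M"
    and "prob_space.indep_var M lebesgue \<Theta>1 lebesgue \<Theta>2"
    and "distr M lebesgue \<Theta>1 = uniform_measure lebesgue {- \<sigma> / 2 .. \<sigma> / 2}"
    and "distr M lebesgue \<Theta>2 = uniform_measure lebesgue {- \<sigma> / 2 .. \<sigma> / 2}"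
    and "1 \<le> L" and "0 < \<sigma>" and "\<sigma> \<le> 2 * pi"
    and "0 < T_cm" and "T_cm < T_fr"
    and "0 < R1" and "0 < R2" and "0 < \<gamma>1" and "0 < \<gamma>2"
    and "e1 = energy T_fr R1 \<gamma>1" and "e2 = energy T_fr R2 \<gamma>2"
  shows "(\<exists>\<pi> \<in> policies L T_cm. half_width_beams M \<Theta>1 \<Theta>2 \<sigma> L \<pi> \<and>
            optimal_alloc M \<Theta>1 \<Theta>2 \<sigma> L T_cm e1 e2 \<pi>) \<and>
         (\<forall>\<pi> \<in> policies L T_cm. half_width_beams M \<Theta>1 \<Theta>2 \<sigma> L \<pi> \<and>
            optimal_alloc M \<Theta>1 \<Theta>2 \<sigma> L T_cm e1 e2 \<pi> \<longrightarrow>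
            is_arg_min (avg_power M \<Theta>1 \<Theta>2 \<sigma> L T_fr T_cm e1 e2) (\<lambda>\<pi>. \<pi> \<in> policies L T_cm) \<pi> \<and>
            avg_power M \<Theta>1 \<Theta>2 \<sigma> L T_fr T_cm e1 e2 \<pi> = min_avg_power M \<Theta>1 \<Theta>2 \<sigma> L T_fr T_cm e1 e2) \<and>
         (\<exists>!\<tau>. \<tau> \<in> {0 <..< T_cm} \<and> deriv e2 (T_cm - \<tau>) / deriv e1 \<tau> = 1) \<and>
         (\<forall>\<tau>. \<tau> \<in> {0 <..< T_cm} \<and> deriv e2 (T_cm - \<tau>) / deriv e1 \<tau> = 1 \<longrightarrow>
            min_avg_power M \<Theta>1 \<Theta>2 \<sigma> L T_fr T_cm e1 e2 =
              \<sigma> / (T_fr * 2 ^ L) * (e1 \<tau> + e2 (T_cm - \<tau>)))"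
proof -
  let ?P = "avg_power M \<Theta>1 \<Theta>2 \<sigma> L T_fr T_cm e1 e2"
  let ?d1 = "energy_slope T_fr R1 \<gamma>1" and ?d2 = "energy_slope T_fr R2 \<gamma>2"
  have T_fr: "0 < T_fr" using assms by simp
  have users: "aligned_users M \<Theta>1 \<Theta>2 \<sigma> T_cm L \<pi>" if "\<pi> \<in> policies L T_cm" for \<pi>
    using assms that
    by (simp add: aligned_users_def aligned_users_axioms_def beam_policy_def)
  \<comment> \<open>The denominator is negative, in particular nonzero, so quotient 1 means equal
    slopes.\<close>
  have stationary: "deriv e2 (T_cm - \<tau>) / deriv e1 \<tau> = 1 \<longleftrightarrow> ?d2 (T_cm - \<tau>) = ?d1 \<tau>"
    if "\<tau> \<in> {0<..<T_cm}" for \<tau>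
    using that energy_slope_neg[of T_fr R1 \<gamma>1 \<tau>] assms T_fr by (auto simp: deriv_energy)
  have ex1: "\<exists>!\<tau>. \<tau> \<in> {0<..<T_cm} \<and> ?d2 (T_cm - \<tau>) = ?d1 \<tau>"
    using assms T_fr
    by (intro ex1_balanced_split energy_slope_strict_mono continuous_on_energy_slope
        filterlim_energy_slope) auto
  then obtain s where s: "s \<in> {0<..<T_cm}" "?d2 (T_cm - s) = ?d1 s" by blast
  define c where "c = \<sigma> / 2 ^ L"
  have c: "0 < c" using assms by (simp add: c_def)
  have pos: "0 < e1 s" "0 < e2 (T_cm - s)"
    using s assms T_fr by (auto intro!: energy_pos)
  have bound: "2 * c * (e1 s + e2 (T_cm - s)) - c\<^sup>2 * (e1 s / u1 + e2 (T_cm - s) / u2)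
      \<le> u1 * e1 t + u2 * e2 (T_cm - t)" if "0 < u1" "0 < u2" "t \<in> {0<..<T_cm}" for u1 u2 t
    unfolding assms(14,15) using assms T_fr c s that by (intro sum_energy_lower_bound) auto
  \<comment> \<open>At \<open>u1 = u2 = c\<close> the lower bound collapses to
    \<open>c * (e1 s + e2 (T_cm - s))\<close>.\<close>
  have min: "e1 s + e2 (T_cm - s) \<le> e1 t + e2 (T_cm - t)" if "t \<in> {0<..<T_cm}" for t
  proof -
    have "c * (e1 s + e2 (T_cm - s)) \<le> c * (e1 t + e2 (T_cm - t))"
      using bound[OF c c that] c by (simp add: power2_eq_square algebra_simps)
    thus ?thesis using c by simp
  qed
  define P where "P = c * (e1 s + e2 (T_cm - s)) / T_fr"
  have lower: "P \<le> ?P \<pi>" if "\<pi> \<in> policies L T_cm" for \<pi>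
    unfolding P_def
    by (intro aligned_users.avg_power_lower_bound[OF users[OF that]] bound c_def pos T_fr)
  have attained: "?P \<pi> = P" if "\<pi> \<in> policies L T_cm" "half_width_beams M \<Theta>1 \<Theta>2 \<sigma> L \<pi>"
    "optimal_alloc M \<Theta>1 \<Theta>2 \<sigma> L T_cm e1 e2 \<pi>" for \<pi>
    unfolding P_def c_def
    by (intro aligned_users.avg_power_bisected[OF users[OF that(1)]] that s min)
  \<comment> \<open>Bisection makes both final widths equal, so the constant allocation
    \<open>s\<close> is optimal at every belief reached.\<close>
  define \<pi>0 where "\<pi>0 = \<lparr>beam = \<lambda>k. bisecting_beam, alloc = \<lambda>_. s\<rparr>"
  have beam: "beam \<pi>0 k S = bisecting_beam S" for k S by (simp add: \<pi>0_def)
  have \<pi>0: "\<pi>0 \<in> policies L T_cm"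
    using s bisecting_beam(1) by (auto simp: policies_def \<pi>0_def bounded_angles_def)
  interpret beam_policy \<sigma> T_cm L \<pi>0
    using users[OF \<pi>0] by (simp add: aligned_users_def)
  have half: "\<forall>k<L. let S = belief_at \<sigma> \<pi>0 k \<theta>1 \<theta>2; B = beam \<pi>0 k S in
        width (support1 S \<inter> B) = 1 / 2 * width (support1 S) \<and>
        width (support2 S \<inter> B) = 1 / 2 * width (support2 S)" for \<theta>1 \<theta>2
  proof (intro allI impI)
    fix k assume "k < L"
    define S where "S = belief_at \<sigma> \<pi>0 k \<theta>1 \<theta>2"
    have "bounded_angles (reg1 (history \<sigma> \<pi>0 k \<theta>1 \<theta>2))" "bounded_angles (reg2 (history \<sigma> \<pi>0 k \<theta>1 \<theta>2))"
      using bounded_angles_region[of "history \<sigma> \<pi>0 k \<theta>1 \<theta>2"] \<open>k < L\<close> by auto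
    from bounded_angles_support[OF this]
    have "bounded_angles (support1 S)" "bounded_angles (support2 S)"
      using \<open>k < L\<close> by (simp_all add: S_def belief_at_eq)
    thus "let S = belief_at \<sigma> \<pi>0 k \<theta>1 \<theta>2; B = beam \<pi>0 k S in
        width (support1 S \<inter> B) = 1 / 2 * width (support1 S) \<and>
        width (support2 S \<inter> B) = 1 / 2 * width (support2 S)"
      unfolding Let_def S_def[symmetric] beam by (rule bisecting_beam(2))
  qed
  hence \<pi>0_half: "half_width_beams M \<Theta>1 \<Theta>2 \<sigma> L \<pi>0"
    unfolding half_width_beams_def by (intro AE_I2)
  have "is_arg_min (total_energy T_cm e1 e2 (belief_at \<sigma> \<pi>0 L \<theta>1 \<theta>2)) (\<lambda>\<tau>. \<tau> \<in> {0<..<T_cm}) s" for \<theta>1 \<theta>2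
    using s(1) min width_support_bisected[OF half] c
    by (auto simp: is_arg_min_linorder total_energy_def c_def[symmetric] distrib_left[symmetric])
  hence \<pi>0_alloc: "optimal_alloc M \<Theta>1 \<Theta>2 \<sigma> L T_cm e1 e2 \<pi>0"
    by (simp add: optimal_alloc_def \<pi>0_def)
  \<comment> \<open>The lower bound \<open>P\<close> is attained by \<open>\<pi>0\<close>, so the
    infimum is a minimum.\<close>
  have inf: "min_avg_power M \<Theta>1 \<Theta>2 \<sigma> L T_fr T_cm e1 e2 = P"
    unfolding min_avg_power_def
    using \<pi>0 attained[OF \<pi>0 \<pi>0_half \<pi>0_alloc] lower
    by (intro cInf_eq_minimum) (auto simp: image_iff)
  show ?thesis
  proof (intro conjI ballI impI allI)
    show "\<exists>\<pi> \<in> policies L T_cm. half_width_beams M \<Theta>1 \<Theta>2 \<sigma> L \<pi> \<and>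
            optimal_alloc M \<Theta>1 \<Theta>2 \<sigma> L T_cm e1 e2 \<pi>"
      using \<pi>0 \<pi>0_half \<pi>0_alloc by blast
  next
    fix \<pi> assume \<pi>: "\<pi> \<in> policies L T_cm"
      "half_width_beams M \<Theta>1 \<Theta>2 \<sigma> L \<pi> \<and> optimal_alloc M \<Theta>1 \<Theta>2 \<sigma> L T_cm e1 e2 \<pi>"
    hence "?P \<pi> = P" by (auto intro: attained)
    thus "?P \<pi> = min_avg_power M \<Theta>1 \<Theta>2 \<sigma> L T_fr T_cm e1 e2"
      and "is_arg_min ?P (\<lambda>\<pi>. \<pi> \<in> policies L T_cm) \<pi>"
      using \<pi>(1) lower by (auto simp: inf is_arg_min_linorder)
  next
    show "\<exists>!\<tau>. \<tau> \<in> {0 <..< T_cm} \<and> deriv e2 (T_cm - \<tau>) / deriv e1 \<tau> = 1"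
      using ex1 stationary by (metis (no_types, lifting))
  next
    fix \<tau> assume "\<tau> \<in> {0 <..< T_cm} \<and> deriv e2 (T_cm - \<tau>) / deriv e1 \<tau> = 1"
    hence "\<tau> = s" using s ex1 stationary by blast
    thus "min_avg_power M \<Theta>1 \<Theta>2 \<sigma> L T_fr T_cm e1 e2 =
              \<sigma> / (T_fr * 2 ^ L) * (e1 \<tau> + e2 (T_cm - \<tau>))"
      by (simp add: inf P_def c_def mult.commute)
  qed
qed

end
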